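(* Let $M \in \mathbb{R}^{C\times C}$. Then $$M P_\pi = P_\pi M \quad \forall \pi \in S_C$$ if and only if $$M = \alpha I_C + \beta\,\mathbf{1}\mathbf{1}^\top$$ for some scalars $\alpha,\beta\in\mathbb{R}$. In particular, any linear permutation-equivariant state coupling must take the form $$h_v(t+1,c) = \alpha\,h_v(t,c) + \beta\sum_{j=1}^C h_v(t,j) + N x(t,c).$$
   Context: $C$ is the number of variables of a multivariate time series; $S_C$ is the symmetric group on $\{1,\dots,C\}$, and $P_\pi\in\mathbb{R}^{C\times C}$ is the permutation matrix of $\pi\in S_C$. $I_C$ is the $C\times C$ identity matrix and $\mathbf{1}$ is the column vector of all ones in $\mathbb{R}^C$. $h_v(t,c)$ is the vertical state and $x(t,c)$ the input of variable $c\in\{1,\dots,C\}$ at discrete time $t$. The linear updates under consideration are of the general form $h_v(t+1,c)=\sum_{j=1}^C M_{c,j}h_v(t,j)+\sum_{j=1}^C N_{c,j}x(t,j)$, where $M,N\in\mathbb{R}^{C\times C}$ govern the inter-variable state coupling and input coupling respectively; permutation equivariance along the variable axis amounts to $MP_\pi=P_\pi M$ and $NP_\pi=P_\pi N$ for all $\pi\in S_C$. The theorem analyzes the state coupling matrix $M$ only; the input coupling is not analyzed, and the input term in the final display is written simply as $N x(t,c)$. *)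

theory Defs
  imports "HOL-Analysis.Analysis"
begin

(* Sends the basis vector with index j to the one with index p j,
   i.e. (perm_matrix p *v v) $ i = v $ (inv p i). *)
definition perm_matrix :: "('n \<Rightarrow> 'n) \<Rightarrow> real ^ 'n ^ 'n::finite" where
  "perm_matrix p = (\<chi> i j. if i = p j then 1 else 0)"

definition ones_col :: "real ^ 1 ^ 'n::finite" where
  "ones_col = columnvector 1"

(* h t c is the vertical state and x t c the input of variable c at time t. *)
definition linear_update ::
  "real ^ 'n ^ 'n::finite \<Rightarrow> real ^ 'n ^ 'n \<Rightarrow> (nat \<Rightarrow> 'n \<Rightarrow> real) \<Rightarrow> (nat \<Rightarrow> 'n \<Rightarrow> real) \<Rightarrow> bool" where
  "linear_update M N h x \<longleftrightarrow>
     (\<forall>t c. h (t + 1) c = (\<Sum>j\<in>UNIV. M $ c $ j * h t j) + (\<Sum>j\<in>UNIV. N $ c $ j * x t j))"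

end

(* Commuting with the permutation matrix of p means M (p i) (p j) = M i j for all i, j.
   The symmetric group acts on index pairs with two orbits, the diagonal and its
   complement, so a commuting M has one value on each. *)
theory Submission
  imports Defs
begin

text \<open>Right multiplication by \<open>perm_matrix p\<close> rearranges columns, left
  multiplication moves row i to row p i; comparing the two products at row p i gives the
  criterion.\<close>

lemma commute_perm_matrix_iff:
  fixes M :: "real ^ 'n ^ 'n::finite"
  assumes "p permutes UNIV"
  shows "M ** perm_matrix p = perm_matrix p ** M \<longleftrightarrow> (\<forall>i j. M $ p i $ p j = M $ i $ j)"
proof -
  have bij: "bij p"
    using assms by (rule permutes_bij)
  have left: "(M ** perm_matrix p) $ i $ j = M $ i $ p j" for i j
    by (simp add: matrix_matrix_mult_def perm_matrix_def if_distrib cong: if_cong)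
  have right: "(perm_matrix p ** M) $ p i $ j = M $ i $ j" for i j
    by (simp add: matrix_matrix_mult_def perm_matrix_def inj_eq[OF bij_is_inj[OF bij]]
        if_distrib[where f = "\<lambda>x. x * _"] cong: if_cong)
  have "M ** perm_matrix p = perm_matrix p ** M \<longleftrightarrow>
      (\<forall>k j. (M ** perm_matrix p) $ k $ j = (perm_matrix p ** M) $ k $ j)"
    by (simp add: vec_eq_iff)
  \<comment> \<open>Surjectivity of p lets every row index be written as p i, so the inverse of p
    never appears.\<close>
  also have "\<dots> \<longleftrightarrow> (\<forall>i j. (M ** perm_matrix p) $ p i $ j = (perm_matrix p ** M) $ p i $ j)"
    using bij_is_surj[OF bij] by (metis surjD)
  finally show ?thesis
    by (simp add: left right)
qed

text \<open>Double transitivity of the symmetric group: it makes the off-diagonal index pairs a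
  single orbit.\<close>

lemma ex_permutes_pair:
  assumes "a \<noteq> b" "c \<noteq> d"
  shows "\<exists>p. p permutes UNIV \<and> p a = c \<and> p b = d"
proof (intro exI conjI)
  \<comment> \<open>The first swap takes a to c. The second takes the image of b to d and leaves c
    alone, since c differs from both.\<close>
  let ?q = "Transposition.transpose a c"
  let ?p = "Transposition.transpose (?q b) d \<circ> ?q"
  show "?p permutes UNIV"
    by (intro permutes_compose permutes_swap_id) auto
  have "?q b \<noteq> c"
    using assms by (auto simp: Transposition.transpose_def)
  then show "?p a = c"
    using assms by (simp add: transpose_apply_other)
  show "?p b = d"
    by simp
qed

lemma scalar_plus_ones_nth:
  "(\<alpha> *\<^sub>R mat 1 + \<beta> *\<^sub>R (ones_col ** transpose ones_col) :: real ^ 'n ^ 'n::finite) $ i $ j =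
    (if i = j then \<alpha> else 0) + \<beta>"
  by (simp add: mat_def ones_col_def columnvector_def transpose_def matrix_matrix_mult_def)

lemma commutes_all_perm_matrix_iff:
  fixes M :: "real ^ 'n ^ 'n::finite"
  shows "(\<forall>\<pi>. \<pi> permutes (UNIV :: 'n set) \<longrightarrow> M ** perm_matrix \<pi> = perm_matrix \<pi> ** M) \<longleftrightarrow>
    (\<exists>\<alpha> \<beta>. M = \<alpha> *\<^sub>R mat 1 + \<beta> *\<^sub>R (ones_col ** transpose ones_col))"
    (is "?commutes \<longleftrightarrow> ?form")
proof
  assume ?commutes
  then have inv: "M $ p i $ p j = M $ i $ j" if "p permutes UNIV" for p i j
    using that commute_perm_matrix_iff by blast
  \<comment> \<open>Swapping two indices carries one diagonal entry to the other.\<close>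
  obtain d where d: "M $ i $ i = d" for i
    using inv[OF permutes_swap_id] by (metis UNIV_I transpose_apply_first)
  have off: "M $ i $ j = M $ k $ l" if "i \<noteq> j" "k \<noteq> l" for i j k l
    using ex_permutes_pair[OF that] inv by metis
  \<comment> \<open>With a single index there is no off-diagonal entry, and any e will do.\<close>
  obtain e where e: "M $ i $ j = e" if "i \<noteq> j" for i j
    using off by metis
  \<comment> \<open>Off the diagonal the form has value \<beta>, on it \<alpha> + \<beta>; hence
    \<beta> = e and \<alpha> = d - e.\<close>
  have "M = (d - e) *\<^sub>R mat 1 + e *\<^sub>R (ones_col ** transpose ones_col)"
    unfolding vec_eq_iff scalar_plus_ones_nth using d e by auto
  then show ?form
    by blast
next
  assume ?form
  then obtain \<alpha> \<beta> where M: "M = \<alpha> *\<^sub>R mat 1 + \<beta> *\<^sub>R (ones_col ** transpose ones_col)"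
    by blast
  show ?commutes
  proof (intro allI impI)
    fix p :: "'n \<Rightarrow> 'n"
    assume p: "p permutes UNIV"
    \<comment> \<open>The entries depend only on whether the indices agree, which an injective p
      preserves.\<close>
    have "M $ p i $ p j = M $ i $ j" for i j
      unfolding M scalar_plus_ones_nth using inj_eq[OF permutes_inj[OF p]] by simp
    then show "M ** perm_matrix p = perm_matrix p ** M"
      using commute_perm_matrix_iff[OF p] by blast
  qed
qed

text \<open>The input term N x(t,c) is read as row c of an arbitrary \<open>N\<close> applied to
  \<open>x t\<close>.\<close>

lemma linear_update_scalar_plus_ones:
  fixes N :: "real ^ 'n ^ 'n::finite"
  assumes "linear_update (\<alpha> *\<^sub>R mat 1 + \<beta> *\<^sub>R (ones_col ** transpose ones_col)) N h x"
  shows "h (t + 1) c =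
    \<alpha> * h t c + \<beta> * (\<Sum>j\<in>UNIV. h t j) + (\<Sum>j\<in>UNIV. N $ c $ j * x t j)"
proof -
  have "(\<Sum>j\<in>UNIV. ((if c = j then \<alpha> else 0) + \<beta>) * h t j) =
      \<alpha> * h t c + \<beta> * (\<Sum>j\<in>UNIV. h t j)"
    by (simp add: distrib_right sum.distrib sum_distrib_left
        if_distrib[where f = "\<lambda>x. x * _"] cong: if_cong)
  then show ?thesis
    using assms unfolding linear_update_def scalar_plus_ones_nth by simp
qed

theorem theorem1:
  fixes M :: "real ^ 'n ^ 'n::finite"
  shows "((\<forall>\<pi>. \<pi> permutes (UNIV :: 'n set) \<longrightarrow> M ** perm_matrix \<pi> = perm_matrix \<pi> ** M) \<longleftrightarrow>
          (\<exists>\<alpha> \<beta>. M = \<alpha> *\<^sub>R mat 1 + \<beta> *\<^sub>R (ones_col ** transpose ones_col)))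
       \<and> ((\<forall>\<pi>. \<pi> permutes (UNIV :: 'n set) \<longrightarrow> M ** perm_matrix \<pi> = perm_matrix \<pi> ** M) \<longrightarrow>
          (\<exists>\<alpha> \<beta>. \<forall>N h x. linear_update M N h x \<longrightarrow>
             (\<forall>t c. h (t + 1) c =
                \<alpha> * h t c + \<beta> * (\<Sum>j\<in>UNIV. h t j) + (\<Sum>j\<in>UNIV. N $ c $ j * x t j))))"
  \<comment> \<open>The scalars come from \<open>M\<close> alone, so one pair serves all
    \<open>N\<close>, \<open>h\<close> and \<open>x\<close>.\<close>
  using commutes_all_perm_matrix_iff[of M] linear_update_scalar_plus_ones by blast

end
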